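(* Let $(X,f)$ be the inverse limit of a bidirectional proximal KR-covering $G_0\xleftarrow{\varphi_1}G_1\xleftarrow{\varphi_2}\cdots$ such that for every $n\ge1$ the graph $G_n$ has exactly two circuits, $e_n$ of length $1$ and $c_n$, and $$\varphi_{n+1}(c_{n+1})=e_n^{s(n)}\,c_n^{t(n)}\,a_n\,c_n^{t'(n)}\,e_n^{s'(n)}\qquad(n\ge1),$$ where $s(n),s'(n),t(n),t'(n)$ are positive integers with $t(n)\ge2$, $t'(n)\ge2$, and $a_n$ is a (possibly empty) concatenation of $e_n$'s and $c_n$'s. Let $p$ be the unique fixed point, $\mu_p$ the point measure at $p$, and suppose that $(X,f)$ has exactly two ergodic measures, with $\mu_c$ the ergodic measure satisfying $\mu_c\ne\mu_p$. Let $W^s(p)=\{x:\lim_{i\to+\infty}f^i(x)=p\}$, $W^u(p)=\{x:\lim_{i\to+\infty}f^{-i}(x)=p\}$ and $K=X\setminus(W^s(p)\cup W^u(p))$. Then $\mu_c(K)=1$ and $\mu_c(U)>0$ for all non-empty open $U\subseteq X$.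
   Context: "Ergodic measure" means ergodic $f$-invariant Borel probability measure. Graph coverings. A finite directed graph $G=(V(G),E(G))$ has $E(G)\subseteq V(G)\times V(G)$, and every vertex is assumed to have an incoming and an outgoing edge. A graph homomorphism $\varphi:G_1\to G_2$ is edge-surjective if $\varphi(E(G_1))=E(G_2)$; it is $+$directional if $(u,v),(u,v')\in E(G_1)$ implies $\varphi(v)=\varphi(v')$; it is bidirectional if moreover $(u,v),(u',v)\in E(G_1)$ implies $\varphi(u)=\varphi(u')$. A cover is a $+$directional edge-surjective homomorphism. A covering is a sequence of covers $G_0\xleftarrow{\varphi_1}G_1\xleftarrow{\varphi_2}\cdots$ with $G_0$ the graph with one vertex and one loop; it is bidirectional if all $\varphi_n$ are. Its inverse limit is $(X,f)$ with $X=\{(v_0,v_1,\dots)\in\prod_nV(G_n): v_n=\varphi_{n+1}(v_{n+1})\}$ (product topology) and $f(x)=y$ iff $(u_n,v_n)\in E(G_n)$ for all $n$, where $x=(u_n)_n$, $y=(v_n)_n$; for a bidirectional covering $f$ is a homeomorphism. A circuit of length $l\ge1$ is a closed walk $(v_0,\dots,v_l=v_0)$ with $v_0,\dots,v_{l-1}$ distinct. A generalized figure 8 is a graph $G$ with a center $v_0$ and distinct circuits starting at $v_0$, pairwise meeting only in $v_0$, whose edges exhaust $E(G)$. A KR-covering is a covering in which each $G_n$ is a generalized figure 8 with center $v_{n,0}$ and $\varphi_{n+1}(v_{n+1,0})=v_{n,0}$ for all $n\ge0$. It is proximal if for each $n\ge1$ the graph $G_n$ has a unique circuit of length $1$. Images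 of walks are taken vertexwise; products and powers of closed walks at the center denote concatenation. The unique fixed point is $p=(v_{0,0},v_{1,0},v_{2,0},\dots)$. *)

theory Defs
  imports
    "HOL-Probability.Probability"
    "Graph_Theory.Pair_Digraph"
    "Graph_Theory.Vertex_Walk"
begin

definition covering_graph :: "'v pair_pre_digraph \<Rightarrow> bool" where
  "covering_graph G \<longleftrightarrow> pair_fin_digraph G \<and>
     (\<forall>v\<in>pverts G. (\<exists>u. (u, v) \<in> parcs G) \<and> (\<exists>w. (v, w) \<in> parcs G))"

definition graph_hom ::
    "'v pair_pre_digraph \<Rightarrow> 'w pair_pre_digraph \<Rightarrow> ('v \<Rightarrow> 'w) \<Rightarrow> bool" where
  "graph_hom G H \<phi> \<longleftrightarrow>
     (\<forall>v\<in>pverts G. \<phi> v \<in> pverts H) \<and> (\<forall>(u, v)\<in>parcs G. (\<phi> u, \<phi> v) \<in> parcs H)"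

definition edge_surjective ::
    "'v pair_pre_digraph \<Rightarrow> 'w pair_pre_digraph \<Rightarrow> ('v \<Rightarrow> 'w) \<Rightarrow> bool" where
  "edge_surjective G H \<phi> \<longleftrightarrow> map_prod \<phi> \<phi> ` parcs G = parcs H"

definition plus_directional :: "'v pair_pre_digraph \<Rightarrow> ('v \<Rightarrow> 'w) \<Rightarrow> bool" where
  "plus_directional G \<phi> \<longleftrightarrow>
     (\<forall>u v v'. (u, v) \<in> parcs G \<longrightarrow> (u, v') \<in> parcs G \<longrightarrow> \<phi> v = \<phi> v')"

definition bidirectional :: "'v pair_pre_digraph \<Rightarrow> ('v \<Rightarrow> 'w) \<Rightarrow> bool" where
  "bidirectional G \<phi> \<longleftrightarrow> plus_directional G \<phi> \<and>
     (\<forall>u u' v. (u, v) \<in> parcs G \<longrightarrow> (u', v) \<in> parcs G \<longrightarrow> \<phi> u = \<phi> u')"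

definition cover ::
    "'v pair_pre_digraph \<Rightarrow> 'w pair_pre_digraph \<Rightarrow> ('v \<Rightarrow> 'w) \<Rightarrow> bool" where
  "cover G H \<phi> \<longleftrightarrow> graph_hom G H \<phi> \<and> edge_surjective G H \<phi> \<and> plus_directional G \<phi>"

text \<open>The bonding map from level \<open>Suc n\<close> to level \<open>n\<close> is \<open>\<phi> (Suc n)\<close>; \<open>\<phi> 0\<close> is
  never used.  All vertex sets live in one type \<open>'v\<close>, which is no restriction because
  the graphs are finite and \<open>'v\<close> is arbitrary.\<close>

definition covering ::
    "(nat \<Rightarrow> 'v pair_pre_digraph) \<Rightarrow> (nat \<Rightarrow> 'v \<Rightarrow> 'v) \<Rightarrow> bool" where
  "covering G \<phi> \<longleftrightarrow>
     (\<forall>n. covering_graph (G n)) \<and>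
     (\<exists>v. pverts (G 0) = {v} \<and> parcs (G 0) = {(v, v)}) \<and>
     (\<forall>n. cover (G (Suc n)) (G n) (\<phi> (Suc n)))"

definition bidirectional_covering ::
    "(nat \<Rightarrow> 'v pair_pre_digraph) \<Rightarrow> (nat \<Rightarrow> 'v \<Rightarrow> 'v) \<Rightarrow> bool" where
  "bidirectional_covering G \<phi> \<longleftrightarrow>
     covering G \<phi> \<and> (\<forall>n. bidirectional (G (Suc n)) (\<phi> (Suc n)))"

text \<open>A circuit of length \<open>l\<close> is the vertex list \<open>[v\<^sub>0, \<dots>, v\<^sub>l]\<close> with \<open>v\<^sub>l = v\<^sub>0\<close>
  written out, so the list itself has length \<open>l + 1\<close>; its length as a walk is
  \<open>vwalk_length\<close>.\<close>

definition circuit :: "'v pair_pre_digraph \<Rightarrow> 'v vwalk \<Rightarrow> bool" where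
  "circuit G w \<longleftrightarrow> vwalk w (with_proj G) \<and> vwalk_length w \<ge> 1 \<and>
     hd w = last w \<and> distinct (butlast w)"

text \<open>In a generalized figure 8 with center \<open>v\<close> every circuit passes through \<open>v\<close>, so
  \<open>circuits_at G v\<close> contains each circuit exactly once up to cyclic rotation.\<close>

definition circuits_at :: "'v pair_pre_digraph \<Rightarrow> 'v \<Rightarrow> 'v vwalk set" where
  "circuits_at G v = {w. circuit G w \<and> hd w = v}"

definition generalized_figure_8 :: "'v pair_pre_digraph \<Rightarrow> 'v \<Rightarrow> bool" where
  "generalized_figure_8 G v \<longleftrightarrow> covering_graph G \<and> v \<in> pverts G \<and>
     (\<exists>C \<subseteq> circuits_at G v.
        (\<forall>c\<in>C. \<forall>d\<in>C. c \<noteq> d \<longrightarrow> set c \<inter> set d = {v}) \<and>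
        (\<Union>c\<in>C. set (vwalk_arcs c)) = parcs G)"

definition KR_covering ::
    "(nat \<Rightarrow> 'v pair_pre_digraph) \<Rightarrow> (nat \<Rightarrow> 'v \<Rightarrow> 'v) \<Rightarrow> (nat \<Rightarrow> 'v) \<Rightarrow> bool" where
  "KR_covering G \<phi> v \<longleftrightarrow> covering G \<phi> \<and>
     (\<forall>n. generalized_figure_8 (G n) (v n)) \<and> (\<forall>n. \<phi> (Suc n) (v (Suc n)) = v n)"

definition proximal :: "(nat \<Rightarrow> 'v pair_pre_digraph) \<Rightarrow> bool" where
  "proximal G \<longleftrightarrow> (\<forall>n\<ge>1. \<exists>!w. circuit (G n) w \<and> vwalk_length w = 1)"

text \<open>Products of closed walks at \<open>v\<close>: consecutive factors share the vertex \<open>v\<close>, which is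
  kept only once.  The empty product is the trivial walk \<open>[v]\<close>.\<close>

definition walk_prod :: "'v \<Rightarrow> 'v vwalk list \<Rightarrow> 'v vwalk" where
  "walk_prod v ws = foldr vwalk_join ws [v]"

definition walk_power :: "'v \<Rightarrow> 'v vwalk \<Rightarrow> nat \<Rightarrow> 'v vwalk" where
  "walk_power v w k = walk_prod v (replicate k w)"

definition inv_limit ::
    "(nat \<Rightarrow> 'v pair_pre_digraph) \<Rightarrow> (nat \<Rightarrow> 'v \<Rightarrow> 'v) \<Rightarrow> (nat \<Rightarrow> 'v) set" where
  "inv_limit G \<phi> =
     {x. (\<forall>n. x n \<in> pverts (G n)) \<and> (\<forall>n. x n = \<phi> (Suc n) (x (Suc n)))}"

definition inv_limit_top ::
    "(nat \<Rightarrow> 'v pair_pre_digraph) \<Rightarrow> (nat \<Rightarrow> 'v \<Rightarrow> 'v) \<Rightarrow> (nat \<Rightarrow> 'v) topology" where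
  "inv_limit_top G \<phi> =
     subtopology (product_topology (\<lambda>n. discrete_topology (pverts (G n))) UNIV) (inv_limit G \<phi>)"

text \<open>For a covering and \<open>x\<close> in the inverse limit, such a \<open>y\<close> exists and is unique since all
  bonding maps are +directional.  Outside the inverse limit the value is irrelevant.\<close>

definition inv_limit_map ::
    "(nat \<Rightarrow> 'v pair_pre_digraph) \<Rightarrow> (nat \<Rightarrow> 'v \<Rightarrow> 'v) \<Rightarrow> (nat \<Rightarrow> 'v) \<Rightarrow> (nat \<Rightarrow> 'v)" where
  "inv_limit_map G \<phi> x = (THE y. y \<in> inv_limit G \<phi> \<and> (\<forall>n. (x n, y n) \<in> parcs (G n)))"

definition borel_of :: "'a topology \<Rightarrow> 'a measure" where
  "borel_of T = sigma (topspace T) {U. openin T U}"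

definition ergodic_measure :: "'a topology \<Rightarrow> ('a \<Rightarrow> 'a) \<Rightarrow> 'a measure \<Rightarrow> bool" where
  "ergodic_measure T f \<mu> \<longleftrightarrow>
     sets \<mu> = sets (borel_of T) \<and> prob_space \<mu> \<and>
     f \<in> measurable \<mu> \<mu> \<and> distr \<mu> \<mu> f = \<mu> \<and>
     (\<forall>A\<in>sets \<mu>. f -` A \<inter> space \<mu> = A \<longrightarrow> measure \<mu> A = 0 \<or> measure \<mu> A = 1)"

definition stable_set :: "'a topology \<Rightarrow> ('a \<Rightarrow> 'a) \<Rightarrow> 'a \<Rightarrow> 'a set" where
  "stable_set T f p = {x \<in> topspace T. limitin T (\<lambda>i. (f ^^ i) x) p sequentially}"

text \<open>Backward iterates; meaningful when \<open>f\<close> is a bijection of \<open>topspace T\<close>, as the inverse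
  limit map of a bidirectional covering is.\<close>

definition unstable_set :: "'a topology \<Rightarrow> ('a \<Rightarrow> 'a) \<Rightarrow> 'a \<Rightarrow> 'a set" where
  "unstable_set T f p =
     {x \<in> topspace T. limitin T (\<lambda>i. (inv_into (topspace T) f ^^ i) x) p sequentially}"

end

theory Submission
  imports Defs
begin

text \<open>
  Since \<open>\<mu>\<^sub>c\<close> is ergodic and differs from the point measure at \<open>p\<close>, the invariant set \<open>{p}\<close>
  has \<open>\<mu>\<^sub>c\<close>-measure zero. Both conclusions follow from this.

  Let \<open>A n\<close> be the cylinder of points whose \<open>n\<close>-th coordinate is the center. These cylinders
  decrease to \<open>{p}\<close>, and \<open>x\<close> is in \<open>W\<^sup>s(p)\<close> iff its orbit is eventually in every \<open>A n\<close>. The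
  points whose orbit stays in \<open>A n\<close> from time \<open>N\<close> on have measure at most \<open>\<mu>\<^sub>c (A n)\<close> by
  invariance, whatever \<open>N\<close> is; letting \<open>N\<close> and then \<open>n\<close> grow bounds the measure of \<open>W\<^sup>s(p)\<close>
  by that of \<open>{p}\<close>, which is zero (\<open>eventually_in_decreasing_null\<close>). For \<open>W\<^sup>u(p)\<close> the same
  argument is applied to \<open>f\<^sup>-\<^sup>1\<close>: reversing all edges of a bidirectional covering yields a
  covering with the same limit space, whose shift is \<open>f\<^sup>-\<^sup>1\<close>
  (\<open>unstable_set_eq_stable_set_converse\<close>).

  For the positivity on open sets it suffices to treat cylinders over vertices of \<open>G n\<close> for
  large \<open>n\<close>. A vertex of the circuit \<open>c n\<close> other than the center has one incoming and one
  outgoing edge, so if two such vertices are consecutive, \<open>f\<close> carries the cylinder over the first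
  exactly onto that over the second; by invariance all these cylinders have the same measure (\<open>measure_cylinder_interior_eq\<close>). This
  common value is positive once \<open>\<mu>\<^sub>c (A n) < 1\<close>. The cylinder over the center of \<open>G n\<close> contains
  the cylinder over the first interior vertex \<open>w\<close> of \<open>c (Suc n)\<close>: the center of \<open>G (Suc n)\<close> has
  edges both to itself and to \<open>w\<close>, so by +directionality \<open>w\<close> has the same image as that center
  (\<open>looped_figure_8_covering_full_support\<close>).
\<close>

section \<open>Cylinders and the topology of the inverse limit\<close>

definition cylinder ::
    "(nat \<Rightarrow> 'v pair_pre_digraph) \<Rightarrow> (nat \<Rightarrow> 'v \<Rightarrow> 'v) \<Rightarrow> nat \<Rightarrow> 'v \<Rightarrow> (nat \<Rightarrow> 'v) set" where
  "cylinder G \<phi> n u = {x \<in> inv_limit G \<phi>. x n = u}"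

lemma inv_limit_vertex: "x \<in> inv_limit G \<phi> \<Longrightarrow> x n \<in> pverts (G n)"
  unfolding inv_limit_def by blast

lemma inv_limit_bonding: "x \<in> inv_limit G \<phi> \<Longrightarrow> x n = \<phi> (Suc n) (x (Suc n))"
  unfolding inv_limit_def by blast

lemma inv_limitI:
  assumes "\<And>n. x n \<in> pverts (G n)" "\<And>n. x n = \<phi> (Suc n) (x (Suc n))"
  shows "x \<in> inv_limit G \<phi>"
  unfolding inv_limit_def using assms by blast

lemma topspace_inv_limit_top [simp]: "topspace (inv_limit_top G \<phi>) = inv_limit G \<phi>"
  by (auto simp: inv_limit_top_def inv_limit_vertex)

lemma space_borel_of [simp]: "space (borel_of T) = topspace T"
  by (simp add: borel_of_def space_measure_of_conv)

lemma openin_in_sets_borel_of: "openin T U \<Longrightarrow> U \<in> sets (borel_of T)"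
  unfolding borel_of_def
  by (subst sets_measure_of) (auto dest: openin_subset)

lemma continuous_map_measurable_borel_of:
  assumes "continuous_map S T g"
  shows "g \<in> measurable (borel_of S) (borel_of T)"
  unfolding borel_of_def[of T]
proof (rule measurable_measure_of)
  show "{U. openin T U} \<subseteq> Pow (topspace T)"
    by (auto dest: openin_subset)
  show "g \<in> space (borel_of S) \<rightarrow> topspace T"
    using assms by (simp add: continuous_map_def)
  show "g -` U \<inter> space (borel_of S) \<in> sets (borel_of S)" if "U \<in> {U. openin T U}" for U
  proof -
    have "g -` U \<inter> space (borel_of S) = {x \<in> topspace S. g x \<in> U}"
      by auto
    then show ?thesis
      using assms that by (simp add: continuous_map_def openin_in_sets_borel_of)
  qed
qed

lemma continuous_map_coordinate:
  "continuous_map (inv_limit_top G \<phi>) (discrete_topology (pverts (G n))) (\<lambda>x. x n)"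
  unfolding inv_limit_top_def
  by (intro continuous_map_from_subtopology continuous_map_product_projection) simp

lemma openin_cylinder: "openin (inv_limit_top G \<phi>) (cylinder G \<phi> n u)"
proof (cases "u \<in> pverts (G n)")
  case True
  have "openin (inv_limit_top G \<phi>) {x \<in> topspace (inv_limit_top G \<phi>). x n \<in> {u}}"
    by (rule openin_continuous_map_preimage[OF continuous_map_coordinate]) (use True in simp)
  then show ?thesis by (simp add: cylinder_def)
next
  case False
  then have "cylinder G \<phi> n u = {}" by (auto simp: cylinder_def dest: inv_limit_vertex)
  then show ?thesis by simp
qed

lemma inv_limit_agree_below:
  assumes "x \<in> inv_limit G \<phi>" "y \<in> inv_limit G \<phi>" "x N = y N" "i \<le> N"
  shows "x i = y i"
  using assms(4)
proof (induction rule: inc_induct)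
  case base
  show ?case by (rule assms(3))
next
  case (step n)
  have "x n = \<phi> (Suc n) (x (Suc n))" "y n = \<phi> (Suc n) (y (Suc n))"
    by (rule inv_limit_bonding[OF assms(1)], rule inv_limit_bonding[OF assms(2)])
  then show ?case using step.IH by simp
qed

text \<open>Cylinders over single vertices form a basis: a basic open set of the product restricts
  finitely many coordinates, and the bonding maps recover these from the highest one.\<close>

lemma openin_contains_cylinder:
  assumes U: "openin (inv_limit_top G \<phi>) U" and x: "x \<in> U"
  obtains N where "cylinder G \<phi> N (x N) \<subseteq> U"
proof -
  obtain W where W: "openin (product_topology (\<lambda>n. discrete_topology (pverts (G n))) UNIV) W"
    and UW: "U = W \<inter> inv_limit G \<phi>"
    using U unfolding inv_limit_top_def openin_subtopology by blast
  have "x \<in> W" using x UW by blast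
  with W obtain B where fin: "finite {i. B i \<noteq> pverts (G i)}" and xB: "x \<in> PiE UNIV B"
    and BW: "PiE UNIV B \<subseteq> W"
    unfolding openin_product_topology_alt by force
  obtain N where N: "\<And>i. B i \<noteq> pverts (G i) \<Longrightarrow> i \<le> N"
    using finite_nat_set_iff_bounded_le[of "{i. B i \<noteq> pverts (G i)}"] fin by auto
  have "y \<in> U" if y: "y \<in> cylinder G \<phi> N (x N)" for y
  proof -
    have yX: "y \<in> inv_limit G \<phi>" and yN: "y N = x N" using y by (auto simp: cylinder_def)
    have xX: "x \<in> inv_limit G \<phi>" using x UW by blast
    have "y i \<in> B i" for i
    proof (cases "B i = pverts (G i)")
      case True
      then show ?thesis using inv_limit_vertex[OF yX] by simp
    next
      case False
      then have "y i = x i" using inv_limit_agree_below[OF yX xX yN] N by simp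
      then show ?thesis using xB by auto
    qed
    then have "y \<in> W" using BW by auto
    then show ?thesis using yX UW by simp
  qed
  then show thesis using that by blast
qed

lemma limitin_inv_limit_top_iff:
  assumes "\<And>i. z i \<in> inv_limit G \<phi>" "p \<in> inv_limit G \<phi>"
  shows "limitin (inv_limit_top G \<phi>) z p sequentially \<longleftrightarrow> (\<forall>n. \<forall>\<^sub>F i in sequentially. z i n = p n)"
proof
  assume L: "limitin (inv_limit_top G \<phi>) z p sequentially"
  show "\<forall>n. \<forall>\<^sub>F i in sequentially. z i n = p n"
  proof
    fix n
    have "p \<in> cylinder G \<phi> n (p n)" using assms(2) by (simp add: cylinder_def)
    then have "\<forall>\<^sub>F i in sequentially. z i \<in> cylinder G \<phi> n (p n)"
      using limitinD[OF L openin_cylinder] by simp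
    then show "\<forall>\<^sub>F i in sequentially. z i n = p n"
      by (rule eventually_mono) (simp add: cylinder_def)
  qed
next
  assume E: "\<forall>n. \<forall>\<^sub>F i in sequentially. z i n = p n"
  show "limitin (inv_limit_top G \<phi>) z p sequentially"
    unfolding limitin_def
  proof (intro conjI allI impI)
    show "p \<in> topspace (inv_limit_top G \<phi>)" using assms(2) by simp
    fix U assume U: "openin (inv_limit_top G \<phi>) U \<and> p \<in> U"
    then obtain N where N: "cylinder G \<phi> N (p N) \<subseteq> U"
      using openin_contains_cylinder by blast
    have "\<forall>\<^sub>F i in sequentially. z i N = p N" using E by blast
    then show "\<forall>\<^sub>F i in sequentially. z i \<in> U"
      by (rule eventually_mono) (use N assms(1) in \<open>auto simp: cylinder_def\<close>)
  qed
qed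

section \<open>The shift map and its inverse\<close>

lemma covering_hom:
  assumes "covering G \<phi>" "(u, w) \<in> parcs (G (Suc n))"
  shows "(\<phi> (Suc n) u, \<phi> (Suc n) w) \<in> parcs (G n)"
  using assms unfolding covering_def cover_def graph_hom_def by blast

lemma covering_directional:
  assumes "covering G \<phi>" "(u, w) \<in> parcs (G (Suc n))" "(u, w') \<in> parcs (G (Suc n))"
  shows "\<phi> (Suc n) w = \<phi> (Suc n) w'"
  using assms unfolding covering_def cover_def plus_directional_def by blast

text \<open>The edges leaving \<open>x (Suc n)\<close> need not determine their end point, but by +directionality
  they determine its image under \<open>\<phi> (Suc n)\<close>, which is therefore the \<open>n\<close>-th coordinate of the
  successor.\<close>

lemma inv_limit_successor:
  assumes cov: "covering G \<phi>" and x: "x \<in> inv_limit G \<phi>"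
  shows "\<exists>!y. y \<in> inv_limit G \<phi> \<and> (\<forall>n. (x n, y n) \<in> parcs (G n))"
proof -
  have graph: "covering_graph (G n)" for n using cov by (simp add: covering_def)
  note hom = covering_hom[OF cov] and pd = covering_directional[OF cov]
  have xn: "x n = \<phi> (Suc n) (x (Suc n))" "x n \<in> pverts (G n)" for n
    by (rule inv_limit_bonding[OF x], rule inv_limit_vertex[OF x])
  have "\<exists>w. (x n, w) \<in> parcs (G n)" for n
    using graph[of n] xn(2)[of n] by (auto simp: covering_graph_def)
  then obtain w where w: "\<And>n. (x n, w n) \<in> parcs (G n)" by metis
  define y where "y n = \<phi> (Suc n) (w (Suc n))" for n
  have arc: "(x n, y n) \<in> parcs (G n)" for n
    using hom[OF w[of "Suc n"]] xn(1)[of n] y_def by metis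
  have "y \<in> inv_limit G \<phi>"
  proof -
    have "y n \<in> pverts (G n)" for n
      using graph[of n] arc[of n]
      by (auto simp: covering_graph_def dest: pair_fin_digraph.axioms(1) pair_wf_digraph.in_arcsD2)
    moreover have "y n = \<phi> (Suc n) (y (Suc n))" for n
      using pd[OF w arc] y_def by metis
    ultimately show ?thesis by (rule inv_limitI)
  qed
  moreover have "z = y" if "z \<in> inv_limit G \<phi>" "\<forall>n. (x n, z n) \<in> parcs (G n)" for z
  proof
    fix n
    have "z n = \<phi> (Suc n) (z (Suc n))" by (rule inv_limit_bonding[OF that(1)])
    also have "\<dots> = y n" using pd[OF _ w] that(2) by (simp add: y_def)
    finally show "z n = y n" .
  qed
  ultimately show ?thesis using arc by blast
qed

lemma
  assumes "covering G \<phi>" "x \<in> inv_limit G \<phi>"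
  shows inv_limit_map_in: "inv_limit_map G \<phi> x \<in> inv_limit G \<phi>"
    and inv_limit_map_arc: "(x n, inv_limit_map G \<phi> x n) \<in> parcs (G n)"
  using theI'[OF inv_limit_successor[OF assms]] by (auto simp: inv_limit_map_def)

lemma inv_limit_map_eqI:
  assumes "covering G \<phi>" "x \<in> inv_limit G \<phi>" "y \<in> inv_limit G \<phi>"
    and "\<And>n. (x n, y n) \<in> parcs (G n)"
  shows "inv_limit_map G \<phi> x = y"
  unfolding inv_limit_map_def
  using assms(3,4) inv_limit_successor[OF assms(1,2)] by (intro the1_equality) auto

lemma funpow_inv_limit_map_in:
  assumes "covering G \<phi>" "x \<in> inv_limit G \<phi>"
  shows "(inv_limit_map G \<phi> ^^ i) x \<in> inv_limit G \<phi>"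
  using assms by (induction i) (auto intro: inv_limit_map_in)

text \<open>Coordinate \<open>N\<close> of the image depends only on coordinate \<open>Suc N\<close> of the argument.\<close>

lemma continuous_map_inv_limit_map:
  assumes cov: "covering G \<phi>"
  shows "continuous_map (inv_limit_top G \<phi>) (inv_limit_top G \<phi>) (inv_limit_map G \<phi>)"
  unfolding continuous_map_def topspace_inv_limit_top
proof (intro conjI allI impI)
  let ?f = "inv_limit_map G \<phi>"
  show "?f \<in> inv_limit G \<phi> \<rightarrow> inv_limit G \<phi>"
    using cov by (auto intro: inv_limit_map_in)
  fix U assume U: "openin (inv_limit_top G \<phi>) U"
  have "\<exists>V. openin (inv_limit_top G \<phi>) V \<and> x \<in> V \<and> V \<subseteq> {x \<in> inv_limit G \<phi>. ?f x \<in> U}"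
    if x: "x \<in> inv_limit G \<phi>" "?f x \<in> U" for x
  proof -
    obtain N where N: "cylinder G \<phi> N (?f x N) \<subseteq> U"
      using openin_contains_cylinder[OF U x(2)] .
    have "?f y \<in> U" if y: "y \<in> cylinder G \<phi> (Suc N) (x (Suc N))" for y
    proof -
      have yX: "y \<in> inv_limit G \<phi>" and eq: "y (Suc N) = x (Suc N)"
        using y by (auto simp: cylinder_def)
      have "?f y N = \<phi> (Suc N) (?f y (Suc N))" "?f x N = \<phi> (Suc N) (?f x (Suc N))"
        by (rule inv_limit_bonding[OF inv_limit_map_in[OF cov yX]],
            rule inv_limit_bonding[OF inv_limit_map_in[OF cov x(1)]])
      moreover have "\<phi> (Suc N) (?f y (Suc N)) = \<phi> (Suc N) (?f x (Suc N))"
        using covering_directional[OF cov inv_limit_map_arc[OF cov yX]]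
          inv_limit_map_arc[OF cov x(1), of "Suc N"] by (simp add: eq)
      ultimately have "?f y \<in> cylinder G \<phi> N (?f x N)"
        using inv_limit_map_in[OF cov yX] by (simp add: cylinder_def)
      then show ?thesis using N by blast
    qed
    then have "cylinder G \<phi> (Suc N) (x (Suc N)) \<subseteq> {x \<in> inv_limit G \<phi>. ?f x \<in> U}"
      by (auto simp: cylinder_def)
    moreover have "x \<in> cylinder G \<phi> (Suc N) (x (Suc N))" using x by (simp add: cylinder_def)
    ultimately show ?thesis
      by (intro exI[of _ "cylinder G \<phi> (Suc N) (x (Suc N))"] conjI openin_cylinder)
  qed
  then show "openin (inv_limit_top G \<phi>) {x \<in> inv_limit G \<phi>. ?f x \<in> U}"
    by (subst openin_subopen) simp
qed

definition converse_graph :: "'v pair_pre_digraph \<Rightarrow> 'v pair_pre_digraph" where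
  "converse_graph G = \<lparr>pverts = pverts G, parcs = (parcs G)\<inverse>\<rparr>"

lemma converse_graph_simps [simp]:
  "pverts (converse_graph G) = pverts G" "parcs (converse_graph G) = (parcs G)\<inverse>"
  by (simp_all add: converse_graph_def)

lemma covering_graph_converse: "covering_graph G \<Longrightarrow> covering_graph (converse_graph G)"
  by (auto simp: covering_graph_def pair_fin_digraph_def pair_wf_digraph_def
      pair_fin_digraph_axioms_def)

text \<open>Bidirectionality is +directionality for both orientations of the edges, so facts on
  forward iteration transfer to the inverse map by reversing the edges.\<close>

lemma covering_converse:
  assumes "bidirectional_covering G \<phi>"
  shows "covering (\<lambda>n. converse_graph (G n)) \<phi>"
  unfolding covering_def
proof (intro conjI allI)
  have cov: "covering G \<phi>" and bi: "\<And>n. bidirectional (G (Suc n)) (\<phi> (Suc n))"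
    using assms by (auto simp: bidirectional_covering_def)
  show "covering_graph (converse_graph (G n))" for n
    using cov by (simp add: covering_def covering_graph_converse)
  show "\<exists>v. pverts (converse_graph (G 0)) = {v} \<and> parcs (converse_graph (G 0)) = {(v, v)}"
    using cov by (auto simp: covering_def)
  show "cover (converse_graph (G (Suc n))) (converse_graph (G n)) (\<phi> (Suc n))" for n
  proof -
    have c: "cover (G (Suc n)) (G n) (\<phi> (Suc n))" using cov by (simp add: covering_def)
    have "map_prod \<psi> \<psi> ` (E\<inverse>) = (map_prod \<psi> \<psi> ` E)\<inverse>" for \<psi> :: "'a \<Rightarrow> 'a" and E
      by force
    then have "edge_surjective (converse_graph (G (Suc n))) (converse_graph (G n)) (\<phi> (Suc n))"
      using c by (simp add: cover_def edge_surjective_def)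
    moreover have "graph_hom (converse_graph (G (Suc n))) (converse_graph (G n)) (\<phi> (Suc n))"
      using c unfolding cover_def graph_hom_def by fastforce
    moreover have "plus_directional (converse_graph (G (Suc n))) (\<phi> (Suc n))"
      using bi[of n] unfolding bidirectional_def plus_directional_def[of "converse_graph _"]
        converse_graph_simps converse_iff by blast
    ultimately show ?thesis by (simp add: cover_def)
  qed
qed

lemma inv_limit_converse [simp]: "inv_limit (\<lambda>n. converse_graph (G n)) \<phi> = inv_limit G \<phi>"
  unfolding inv_limit_def converse_graph_simps ..

lemma inv_limit_top_converse [simp]:
  "inv_limit_top (\<lambda>n. converse_graph (G n)) \<phi> = inv_limit_top G \<phi>"
  by (simp add: inv_limit_top_def)

lemma
  assumes bi: "bidirectional_covering G \<phi>" and x: "x \<in> inv_limit G \<phi>"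
  shows inv_limit_map_converse_left:
      "inv_limit_map (\<lambda>n. converse_graph (G n)) \<phi> (inv_limit_map G \<phi> x) = x"
    and inv_limit_map_converse_right:
      "inv_limit_map G \<phi> (inv_limit_map (\<lambda>n. converse_graph (G n)) \<phi> x) = x"
proof -
  have cov: "covering G \<phi>" using bi by (simp add: bidirectional_covering_def)
  note covT = covering_converse[OF bi]
  note f = inv_limit_map_in[OF cov x] inv_limit_map_arc[OF cov x]
  have xT: "x \<in> inv_limit (\<lambda>n. converse_graph (G n)) \<phi>" using x by simp
  note g = inv_limit_map_in[OF covT xT] inv_limit_map_arc[OF covT xT]
  show "inv_limit_map (\<lambda>n. converse_graph (G n)) \<phi> (inv_limit_map G \<phi> x) = x"
    using f x by (intro inv_limit_map_eqI[OF covT]) auto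
  show "inv_limit_map G \<phi> (inv_limit_map (\<lambda>n. converse_graph (G n)) \<phi> x) = x"
    using g x by (intro inv_limit_map_eqI[OF cov]) auto
qed

lemma inj_on_inv_limit_map:
  assumes "bidirectional_covering G \<phi>"
  shows "inj_on (inv_limit_map G \<phi>) (inv_limit G \<phi>)"
  by (rule inj_on_inverseI) (rule inv_limit_map_converse_left[OF assms])

lemma unstable_set_eq_stable_set_converse:
  assumes bi: "bidirectional_covering G \<phi>"
  shows "unstable_set (inv_limit_top G \<phi>) (inv_limit_map G \<phi>) p =
    stable_set (inv_limit_top G \<phi>) (inv_limit_map (\<lambda>n. converse_graph (G n)) \<phi>) p"
proof -
  let ?f = "inv_limit_map G \<phi>" and ?g = "inv_limit_map (\<lambda>n. converse_graph (G n)) \<phi>"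
  note covT = covering_converse[OF bi]
  have in_X: "(?g ^^ i) x \<in> inv_limit G \<phi>" if "x \<in> inv_limit G \<phi>" for x i
    using funpow_inv_limit_map_in[OF covT] that by simp
  have inv: "inv_into (inv_limit G \<phi>) ?f x = ?g x" if "x \<in> inv_limit G \<phi>" for x
    using inv_into_f_eq[OF inj_on_inv_limit_map[OF bi]] in_X[OF that, of 1]
      inv_limit_map_converse_right[OF bi that] by simp
  have "(inv_into (inv_limit G \<phi>) ?f ^^ i) x = (?g ^^ i) x" if x: "x \<in> inv_limit G \<phi>" for x i
    by (induction i) (simp_all add: inv in_X[OF x])
  then show ?thesis
    unfolding unstable_set_def stable_set_def topspace_inv_limit_top
    by (auto simp: cong: limitin_sequentially)
qed

section \<open>Convergence to a point of measure zero is a null event\<close>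

text \<open>By invariance, staying in \<open>A n\<close> from time \<open>N\<close> on is at most as likely as being in \<open>A n\<close>
  at time \<open>0\<close>. The bound does not depend on \<open>N\<close>, so it survives the increasing union over \<open>N\<close>,
  and then it tends to zero with \<open>n\<close>.\<close>

lemma (in prob_space) eventually_in_decreasing_null:
  assumes f: "f \<in> measurable M M" and inv: "distr M M f = M"
    and A: "\<And>n. A n \<in> sets M" and dec: "decseq A" and null: "prob (\<Inter>n. A n) = 0"
  defines "W \<equiv> {x \<in> space M. \<forall>n. \<forall>\<^sub>F i in sequentially. (f ^^ i) x \<in> A n}"
  shows "W \<in> sets M" and "prob W = 0"
proof -
  have fi: "f ^^ i \<in> measurable M M" for i
    by (rule measurable_compose_n[OF f])
  have inv_i: "prob ((f ^^ i) -` B \<inter> space M) = prob B" if B: "B \<in> sets M" for B i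
  proof (induction i)
    case 0
    show ?case using sets.sets_into_space[OF B] by (simp add: Int_absorb2)
  next
    case (Suc i)
    let ?C = "(f ^^ i) -` B \<inter> space M"
    have C: "?C \<in> sets M" using measurable_sets[OF fi B] .
    have "(f ^^ Suc i) -` B \<inter> space M = f -` ?C \<inter> space M"
      using measurable_space[OF f] by (auto simp: funpow_swap1)
    then have "prob ((f ^^ Suc i) -` B \<inter> space M) = measure (distr M M f) ?C"
      using measure_distr[OF f C] by simp
    then show ?case by (simp only: inv Suc.IH)
  qed
  define tail where "tail n N = {x \<in> space M. \<forall>i\<ge>N. (f ^^ i) x \<in> A n}" for n N
  have tail_eq: "tail n N = (\<Inter>i\<in>{N..}. (f ^^ i) -` A n \<inter> space M)" for n N
    by (auto simp: tail_def)
  have tail_sets: "tail n N \<in> sets M" for n N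
    unfolding tail_eq by (intro sets.countable_INT') (auto intro: measurable_sets[OF fi A])
  have W_eq: "W = (\<Inter>n. \<Union>N. tail n N)"
    by (auto simp: W_def tail_def eventually_sequentially)
  show "W \<in> sets M"
    unfolding W_eq using tail_sets by blast
  have tail_le: "prob (tail n N) \<le> prob (A n)" for n N
  proof -
    have "prob (tail n N) \<le> prob ((f ^^ N) -` A n \<inter> space M)"
      by (intro finite_measure_mono measurable_sets[OF fi A]) (auto simp: tail_def)
    then show ?thesis by (simp add: inv_i A)
  qed
  have "prob W \<le> prob (A n)" for n
  proof -
    have "incseq (tail n)"
      unfolding incseq_def tail_def using order_trans by blast
    then have "(\<lambda>N. prob (tail n N)) \<longlonglongrightarrow> prob (\<Union>N. tail n N)"
      using tail_sets by (intro finite_Lim_measure_incseq) blast+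
    then have "prob (\<Union>N. tail n N) \<le> prob (A n)"
      by (rule LIMSEQ_le_const2) (simp add: tail_le)
    moreover have "prob W \<le> prob (\<Union>N. tail n N)"
      unfolding W_eq using tail_sets by (intro finite_measure_mono) auto
    ultimately show ?thesis by simp
  qed
  moreover have "(\<lambda>n. prob (A n)) \<longlonglongrightarrow> prob (\<Inter>n. A n)"
    using A dec by (intro finite_Lim_measure_decseq) auto
  ultimately have "prob W \<le> 0"
    using null by (auto intro: LIMSEQ_le_const)
  then show "prob W = 0" by (simp add: measure_le_0_iff)
qed

lemma decseq_cylinder:
  assumes p: "p \<in> inv_limit G \<phi>"
  shows "decseq (\<lambda>n. cylinder G \<phi> n (p n))"
  unfolding decseq_def cylinder_def using inv_limit_agree_below[OF _ p] by blast

lemma Inter_cylinder: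
  assumes "p \<in> inv_limit G \<phi>"
  shows "(\<Inter>n. cylinder G \<phi> n (p n)) = {p}"
  using assms by (auto simp: cylinder_def)

lemma stable_set_null:
  assumes cov: "covering G \<phi>" and p: "p \<in> inv_limit G \<phi>"
    and \<mu>: "prob_space \<mu>" "sets \<mu> = sets (borel_of (inv_limit_top G \<phi>))"
    and inv: "distr \<mu> \<mu> (inv_limit_map G \<phi>) = \<mu>"
    and null: "measure \<mu> {p} = 0"
  shows "stable_set (inv_limit_top G \<phi>) (inv_limit_map G \<phi>) p \<in> sets \<mu>"
    and "measure \<mu> (stable_set (inv_limit_top G \<phi>) (inv_limit_map G \<phi>) p) = 0"
proof -
  interpret prob_space \<mu> by (rule \<mu>(1))
  let ?f = "inv_limit_map G \<phi>"
  have space: "space \<mu> = inv_limit G \<phi>" using sets_eq_imp_space_eq[OF \<mu>(2)] by simp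
  have f: "?f \<in> measurable \<mu> \<mu>"
    using continuous_map_measurable_borel_of[OF continuous_map_inv_limit_map[OF cov]] \<mu>(2)
    by (simp cong: measurable_cong_sets)
  have eq: "stable_set (inv_limit_top G \<phi>) ?f p =
      {x \<in> space \<mu>. \<forall>n. \<forall>\<^sub>F i in sequentially. (?f ^^ i) x \<in> cylinder G \<phi> n (p n)}"
    using limitin_inv_limit_top_iff[OF funpow_inv_limit_map_in[OF cov] p]
      funpow_inv_limit_map_in[OF cov]
    by (auto simp: stable_set_def space cylinder_def)
  have A: "cylinder G \<phi> n (p n) \<in> sets \<mu>" for n
    using openin_in_sets_borel_of[OF openin_cylinder] \<mu>(2) by simp
  have N: "prob (\<Inter>n. cylinder G \<phi> n (p n)) = 0"
    using null by (simp add: Inter_cylinder[OF p])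
  note * = eventually_in_decreasing_null[OF f inv A decseq_cylinder[OF p] N]
  show "stable_set (inv_limit_top G \<phi>) ?f p \<in> sets \<mu>" using *(1) eq by simp
  show "measure \<mu> (stable_set (inv_limit_top G \<phi>) ?f p) = 0" using *(2) eq by simp
qed

lemma unstable_set_null:
  assumes bi: "bidirectional_covering G \<phi>" and p: "p \<in> inv_limit G \<phi>"
    and \<mu>: "prob_space \<mu>" "sets \<mu> = sets (borel_of (inv_limit_top G \<phi>))"
    and inv: "distr \<mu> \<mu> (inv_limit_map G \<phi>) = \<mu>"
    and null: "measure \<mu> {p} = 0"
  shows "unstable_set (inv_limit_top G \<phi>) (inv_limit_map G \<phi>) p \<in> sets \<mu>"
    and "measure \<mu> (unstable_set (inv_limit_top G \<phi>) (inv_limit_map G \<phi>) p) = 0"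
proof -
  let ?f = "inv_limit_map G \<phi>" and ?g = "inv_limit_map (\<lambda>n. converse_graph (G n)) \<phi>"
  have cov: "covering G \<phi>" using bi by (simp add: bidirectional_covering_def)
  note covT = covering_converse[OF bi]
  have space: "space \<mu> = inv_limit G \<phi>" using sets_eq_imp_space_eq[OF \<mu>(2)] by simp
  have f: "?f \<in> measurable \<mu> \<mu>"
    using continuous_map_measurable_borel_of[OF continuous_map_inv_limit_map[OF cov]] \<mu>(2)
    by (simp cong: measurable_cong_sets)
  have g: "?g \<in> measurable \<mu> \<mu>"
    using continuous_map_measurable_borel_of[OF continuous_map_inv_limit_map[OF covT]] \<mu>(2)
    by (simp cong: measurable_cong_sets)
  have "distr \<mu> \<mu> ?g = distr (distr \<mu> \<mu> ?f) \<mu> ?g" by (simp add: inv)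
  also have "\<dots> = distr \<mu> \<mu> (?g \<circ> ?f)" by (rule distr_distr[OF g f])
  also have "\<dots> = distr \<mu> \<mu> (\<lambda>x. x)"
    using inv_limit_map_converse_left[OF bi] by (intro distr_cong) (simp_all add: space)
  also have "\<dots> = \<mu>" by (rule distr_id)
  finally have "distr \<mu> \<mu> ?g = \<mu>" .
  then have
    "stable_set (inv_limit_top G \<phi>) ?g p \<in> sets \<mu> \<and>
     measure \<mu> (stable_set (inv_limit_top G \<phi>) ?g p) = 0"
    using stable_set_null[OF covT, of p \<mu>] p \<mu> null by simp
  then show "unstable_set (inv_limit_top G \<phi>) ?f p \<in> sets \<mu>"
    and "measure \<mu> (unstable_set (inv_limit_top G \<phi>) ?f p) = 0"
    by (simp_all add: unstable_set_eq_stable_set_converse[OF bi])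
qed

section \<open>Ergodic measures and a fixed point\<close>

lemma prob_space_eq_return:
  assumes "prob_space \<mu>" "sets \<mu> = sets M" "{p} \<in> sets \<mu>" "measure \<mu> {p} = 1"
  shows "\<mu> = return M p"
proof (rule measure_eqI)
  show "sets \<mu> = sets (return M p)" by (simp only: assms(2) sets_return)
next
  interpret prob_space \<mu> by (rule assms(1))
  fix A assume A: "A \<in> sets \<mu>"
  have "prob A = indicator A p"
  proof (cases "p \<in> A")
    case True
    have "prob {p} \<le> prob A" using A True by (intro finite_measure_mono) simp_all
    then show ?thesis using True assms(4) prob_le_1[of A] by simp
  next
    case False
    then have "prob (A \<union> {p}) = prob A + prob {p}"
      using finite_measure_Union[OF A assms(3)] by blast
    then show ?thesis using False assms(4) prob_le_1[of "A \<union> {p}"] measure_nonneg[of \<mu> A] by simp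
  qed
  then show "emeasure \<mu> A = emeasure (return M p) A"
    using A assms(2) emeasure_return[of A M p] by (simp add: emeasure_eq_measure indicator_def)
qed

text \<open>As \<open>f\<close> is injective, a fixed point is an invariant set, so ergodicity gives it measure
  zero or one; measure one would make \<open>\<mu>\<close> the point measure.\<close>

lemma ergodic_measure_fixed_point_null:
  assumes bi: "bidirectional_covering G \<phi>" and p: "p \<in> inv_limit G \<phi>"
    and fp: "inv_limit_map G \<phi> p = p"
    and erg: "ergodic_measure (inv_limit_top G \<phi>) (inv_limit_map G \<phi>) \<mu>"
    and ne: "\<mu> \<noteq> return (borel_of (inv_limit_top G \<phi>)) p"
  shows "measure \<mu> {p} = 0"
proof -
  let ?f = "inv_limit_map G \<phi>"
  have sets: "sets \<mu> = sets (borel_of (inv_limit_top G \<phi>))" and prob: "prob_space \<mu>"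
    using erg by (auto simp: ergodic_measure_def)
  have space: "space \<mu> = inv_limit G \<phi>" using sets_eq_imp_space_eq[OF sets] by simp
  have "cylinder G \<phi> n (p n) \<in> sets \<mu>" for n
    using openin_in_sets_borel_of[OF openin_cylinder] sets by simp
  then have "(\<Inter>n. cylinder G \<phi> n (p n)) \<in> sets \<mu>"
    by (intro sets.countable_INT') auto
  then have p_sets: "{p} \<in> sets \<mu>" by (simp add: Inter_cylinder[OF p])
  have "?f -` {p} \<inter> space \<mu> = {p}"
    using inj_on_inv_limit_map[OF bi] p fp by (auto simp: space inj_on_def)
  then have "measure \<mu> {p} = 0 \<or> measure \<mu> {p} = 1"
    using erg p_sets by (simp add: ergodic_measure_def)
  then show ?thesis using prob_space_eq_return[OF prob sets p_sets] ne by blast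
qed

section \<open>Cylinders over a figure 8 with a loop\<close>

lemma vwalk_arcs_conv_zip: "vwalk_arcs w = zip w (tl w)"
  by (induction w rule: vwalk_arcs.induct) auto

lemma set_vwalk_arcs: "set (vwalk_arcs w) = {(w ! i, w ! Suc i) | i. Suc i < length w}"
  by (auto simp: vwalk_arcs_conv_zip set_zip nth_tl)

text \<open>A generalized figure 8 with exactly two circuits, one of which is the loop at the center.
  Vertices of \<open>c\<close> are addressed by their index; the indices \<open>0\<close> and \<open>length c - 1\<close> both denote the
  center, and those strictly between are called interior.\<close>

locale looped_figure_8 =
  fixes G :: "'v pair_pre_digraph" and v :: 'v and c :: "'v vwalk"
  assumes figure_8: "generalized_figure_8 G v"
    and circuits: "circuits_at G v = {[v, v], c}"
    and c_not_loop: "c \<noteq> [v, v]"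
begin

lemma circuit_c: "circuit G c" and hd_c: "hd c = v" and last_c: "last c = v"
proof -
  have "c \<in> circuits_at G v" using circuits by simp
  then show "circuit G c" "hd c = v" "last c = v"
    unfolding circuits_at_def circuit_def by auto
qed

lemma length_c: "length c \<ge> 3"
proof (rule ccontr)
  assume "\<not> length c \<ge> 3"
  moreover have "length c \<ge> 2" using circuit_c unfolding circuit_def vwalk_length_simp by arith
  ultimately have "length c = 2" by simp
  then obtain x y where "c = [x, y]" by (auto simp: numeral_2_eq_2 length_Suc_conv)
  then show False using hd_c last_c c_not_loop by simp
qed

lemma nth_c_0: "c ! 0 = v"
  using hd_c length_c hd_conv_nth[of c] by fastforce

lemma nth_c_last: "c ! (length c - 1) = v"
  using last_c length_c last_conv_nth[of c] by fastforce

lemma nth_c_eq_iff: "\<lbrakk>i < length c - 1; j < length c - 1\<rbrakk> \<Longrightarrow> c ! i = c ! j \<longleftrightarrow> i = j"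
  using circuit_c nth_eq_iff_index_eq[of "butlast c" i j] by (simp add: circuit_def nth_butlast)

lemma interior_neq_center: "\<lbrakk>0 < i; i < length c - 1\<rbrakk> \<Longrightarrow> c ! i \<noteq> v"
  using nth_c_eq_iff[of i 0] nth_c_0 by simp

lemma loop_arc: "(v, v) \<in> parcs G"
proof -
  have "[v, v] \<in> circuits_at G v" using circuits by simp
  then show ?thesis by (simp add: circuits_at_def circuit_def vwalk_def)
qed

lemma c_arc: "Suc i < length c \<Longrightarrow> (c ! i, c ! Suc i) \<in> parcs G"
  using circuit_c by (auto simp: circuit_def vwalk_def set_vwalk_arcs)

lemma arc_cases:
  assumes "(x, y) \<in> parcs G"
  obtains "x = v" "y = v" | i where "Suc i < length c" "x = c ! i" "y = c ! Suc i"
proof -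
  obtain C where "C \<subseteq> {[v, v], c}" "(\<Union>w\<in>C. set (vwalk_arcs w)) = parcs G"
    using figure_8 circuits by (auto simp: generalized_figure_8_def)
  then have "parcs G \<subseteq> set (vwalk_arcs [v, v]) \<union> set (vwalk_arcs c)" by blast
  then show thesis using assms that by (auto simp: set_vwalk_arcs)
qed

lemma vertex_on_c:
  assumes "u \<in> pverts G"
  obtains i where "i < length c - 1" "u = c ! i"
proof -
  obtain w where "(u, w) \<in> parcs G"
    using figure_8 assms by (auto simp: generalized_figure_8_def covering_graph_def)
  then show thesis
  proof (cases rule: arc_cases)
    case 1
    then show ?thesis using that[of 0] nth_c_0 length_c by simp
  next
    case (2 i)
    then show ?thesis using that[of i] by simp
  qed
qed

lemma arc_from_interior:
  assumes "0 < i" "Suc i < length c" "(c ! i, y) \<in> parcs G"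
  shows "y = c ! Suc i"
  using assms(3)
proof (cases rule: arc_cases)
  case 1
  then show ?thesis using interior_neq_center[of i] assms by simp
next
  case (2 j)
  then show ?thesis using nth_c_eq_iff[of i j] assms by simp
qed

lemma arc_to_interior:
  assumes "Suc i < length c - 1" "(x, c ! Suc i) \<in> parcs G"
  shows "x = c ! i"
  using assms(2)
proof (cases rule: arc_cases)
  case 1
  then show ?thesis using interior_neq_center[of "Suc i"] assms by simp
next
  case (2 j)
  have "c ! Suc j \<noteq> v"
    using 2(3) interior_neq_center[of "Suc i"] assms(1) by simp
  then have "Suc j \<noteq> length c - 1" using nth_c_last by metis
  then have "Suc j < length c - 1" using 2(1) by simp
  then show ?thesis using 2 nth_c_eq_iff[of "Suc i" "Suc j"] assms by simp
qed

end

text \<open>Over the interior of the circuit the graph is a simple path, so each of these cylinders is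
  the full preimage under \<open>f\<close> of the next one.\<close>

lemma measure_cylinder_interior_eq:
  assumes cov: "covering G \<phi>" and fig: "looped_figure_8 (G n) v c"
    and \<mu>: "sets \<mu> = sets (borel_of (inv_limit_top G \<phi>))"
    and f: "inv_limit_map G \<phi> \<in> measurable \<mu> \<mu>"
    and inv: "distr \<mu> \<mu> (inv_limit_map G \<phi>) = \<mu>"
    and i: "0 < i" "i < length c - 1"
  shows "measure \<mu> (cylinder G \<phi> n (c ! i)) = measure \<mu> (cylinder G \<phi> n (c ! 1))"
  using i
proof (induction i rule: nat_induct_non_zero)
  case 1
  show ?case by simp
next
  case (Suc i)
  interpret looped_figure_8 "G n" v c by (rule fig)
  let ?f = "inv_limit_map G \<phi>"
  have space: "space \<mu> = inv_limit G \<phi>" using sets_eq_imp_space_eq[OF \<mu>] by simp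
  have "?f x n = c ! Suc i \<longleftrightarrow> x n = c ! i" if x: "x \<in> inv_limit G \<phi>" for x
  proof
    assume "?f x n = c ! Suc i"
    then show "x n = c ! i"
      using arc_to_interior[of i "x n"] inv_limit_map_arc[OF cov x, of n] Suc.prems by simp
  next
    assume "x n = c ! i"
    then show "?f x n = c ! Suc i"
      using arc_from_interior[of i "?f x n"] inv_limit_map_arc[OF cov x, of n] Suc.hyps Suc.prems
      by simp
  qed
  then have "cylinder G \<phi> n (c ! i) = ?f -` cylinder G \<phi> n (c ! Suc i) \<inter> space \<mu>"
    using inv_limit_map_in[OF cov] by (auto simp: cylinder_def space)
  then have "measure \<mu> (cylinder G \<phi> n (c ! i)) = measure (distr \<mu> \<mu> ?f) (cylinder G \<phi> n (c ! Suc i))"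
    using measure_distr[OF f, of "cylinder G \<phi> n (c ! Suc i)"] \<mu>
      openin_in_sets_borel_of[OF openin_cylinder[of G \<phi> n "c ! Suc i"]] by simp
  then show ?case using Suc by (simp add: inv)
qed

section \<open>Full support\<close>

text \<open>If the interior cylinders at some level had measure zero, the cylinder over the center would
  carry the whole measure at that level; this fails at all high levels, because these cylinders
  shrink to the null set \<open>{v}\<close>. A cylinder over a center contains one over an interior vertex of
  the next level.\<close>

lemma looped_figure_8_covering_full_support:
  assumes cov: "covering G \<phi>" and p: "v \<in> inv_limit G \<phi>"
    and fig: "\<And>n. n \<ge> 1 \<Longrightarrow> looped_figure_8 (G n) (v n) (c n)"
    and \<mu>: "prob_space \<mu>" "sets \<mu> = sets (borel_of (inv_limit_top G \<phi>))"
    and f: "inv_limit_map G \<phi> \<in> measurable \<mu> \<mu>"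
    and inv: "distr \<mu> \<mu> (inv_limit_map G \<phi>) = \<mu>"
    and null: "measure \<mu> {v} = 0"
    and U: "openin (inv_limit_top G \<phi>) U" "U \<noteq> {}"
  shows "measure \<mu> U > 0"
proof -
  interpret prob_space \<mu> by (rule \<mu>(1))
  let ?Z = "cylinder G \<phi>"
  have Z_sets: "?Z n u \<in> sets \<mu>" for n u
    using openin_in_sets_borel_of[OF openin_cylinder] \<mu>(2) by simp
  have space: "space \<mu> = inv_limit G \<phi>" using sets_eq_imp_space_eq[OF \<mu>(2)] by simp
  have "(\<lambda>n. prob (?Z n (v n))) \<longlonglongrightarrow> prob (\<Inter>n. ?Z n (v n))"
    using Z_sets decseq_cylinder[OF p] by (intro finite_Lim_measure_decseq) auto
  then have "(\<lambda>n. prob (?Z n (v n))) \<longlonglongrightarrow> 0" using null by (simp add: Inter_cylinder[OF p])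
  then have "\<forall>\<^sub>F n in sequentially. prob (?Z n (v n)) < 1"
    by (rule order_tendstoD) simp
  then obtain m where m: "\<And>n. n \<ge> m \<Longrightarrow> prob (?Z n (v n)) < 1"
    by (auto simp: eventually_sequentially)
  have interior: "prob (?Z n (c n ! i)) > 0"
    if n: "n \<ge> 1" "n \<ge> m" and i: "0 < i" "i < length (c n) - 1" for n i
  proof -
    interpret F: looped_figure_8 "G n" "v n" "c n" by (rule fig[OF n(1)])
    note eq = measure_cylinder_interior_eq[OF cov fig[OF n(1)] \<mu>(2) f inv]
    show ?thesis
    proof (rule ccontr)
      assume "\<not> prob (?Z n (c n ! i)) > 0"
      then have "prob (?Z n (c n ! i)) = 0" by (simp add: zero_less_measure_iff)
      then have z: "prob (?Z n (c n ! j)) = 0" if "0 < j" "j < length (c n) - 1" for j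
        using eq[OF i] eq[OF that] by simp
      have "space \<mu> \<subseteq> ?Z n (v n) \<union> (\<Union>j\<in>{0<..<length (c n) - 1}. ?Z n (c n ! j))"
      proof
        fix x assume "x \<in> space \<mu>"
        then have x: "x \<in> inv_limit G \<phi>" by (simp add: space)
        then have "x n \<in> pverts (G n)" by (rule inv_limit_vertex)
        then obtain j where j: "j < length (c n) - 1" "x n = c n ! j" by (rule F.vertex_on_c)
        show "x \<in> ?Z n (v n) \<union> (\<Union>j\<in>{0<..<length (c n) - 1}. ?Z n (c n ! j))"
          using j x F.nth_c_0 by (cases "j = 0") (auto simp: cylinder_def)
      qed
      then have "prob (space \<mu>) \<le> prob (?Z n (v n) \<union> (\<Union>j\<in>{0<..<length (c n) - 1}. ?Z n (c n ! j)))"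
        using Z_sets by (intro finite_measure_mono) auto
      also have "\<dots> \<le> prob (?Z n (v n)) + prob (\<Union>j\<in>{0<..<length (c n) - 1}. ?Z n (c n ! j))"
        using Z_sets by (intro measure_Un_le) auto
      also have "prob (\<Union>j\<in>{0<..<length (c n) - 1}. ?Z n (c n ! j))
          \<le> (\<Sum>j\<in>{0<..<length (c n) - 1}. prob (?Z n (c n ! j)))"
        using Z_sets by (intro measure_UNION_le) auto
      also have "\<dots> = 0" using z by simp
      finally show False using m[OF n(2)] by (simp add: prob_space)
    qed
  qed
  have vertex: "prob (?Z n u) > 0" if n: "n \<ge> 1" "n \<ge> m" and u: "u \<in> pverts (G n)" for n u
  proof -
    interpret F: looped_figure_8 "G n" "v n" "c n" by (rule fig[OF n(1)])
    interpret F': looped_figure_8 "G (Suc n)" "v (Suc n)" "c (Suc n)" by (rule fig) simp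
    obtain i where i: "i < length (c n) - 1" "u = c n ! i" using u by (rule F.vertex_on_c)
    show ?thesis
    proof (cases "i = 0")
      case False
      then show ?thesis using interior[OF n] i by simp
    next
      case True
      then have u: "u = v n" using i F.nth_c_0 by simp
      \<comment> \<open>The loop and the first edge of \<open>c (Suc n)\<close> leave the same vertex, so
        +directionality identifies their end points one level below.\<close>
      let ?w = "c (Suc n) ! 1"
      have "(v (Suc n), ?w) \<in> parcs (G (Suc n))"
        using F'.c_arc[of 0] F'.nth_c_0 F'.length_c by simp
      then have "\<phi> (Suc n) ?w = \<phi> (Suc n) (v (Suc n))"
        using covering_directional[OF cov] F'.loop_arc by blast
      also have "\<dots> = v n" by (rule inv_limit_bonding[OF p, symmetric])
      finally have w: "\<phi> (Suc n) ?w = u" by (simp only: u)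
      have "?Z (Suc n) ?w \<subseteq> ?Z n u"
      proof
        fix x assume x: "x \<in> ?Z (Suc n) ?w"
        then have "x n = \<phi> (Suc n) (x (Suc n))"
          by (intro inv_limit_bonding[of x G]) (simp add: cylinder_def)
        then show "x \<in> ?Z n u" using x w by (simp add: cylinder_def)
      qed
      then have "prob (?Z (Suc n) ?w) \<le> prob (?Z n u)" using Z_sets by (intro finite_measure_mono)
      moreover have "prob (?Z (Suc n) ?w) > 0"
        using interior[of "Suc n" 1] n F'.length_c by simp
      ultimately show ?thesis by simp
    qed
  qed
  obtain x where x: "x \<in> U" using U(2) by blast
  have xX: "x \<in> inv_limit G \<phi>" using openin_subset[OF U(1)] x by auto
  obtain N where N: "?Z N (x N) \<subseteq> U" using openin_contains_cylinder[OF U(1) x] .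
  \<comment> \<open>A level at which \<open>vertex\<close> applies and whose cylinders refine those of level \<open>N\<close>.\<close>
  define n where "n = N + m + 1"
  have "?Z n (x n) \<subseteq> ?Z N (x N)"
    using inv_limit_agree_below[OF _ xX, of _ n N] by (auto simp: cylinder_def n_def)
  then have "prob (?Z n (x n)) \<le> prob U"
    using N openin_in_sets_borel_of[OF U(1)] \<mu>(2) by (intro finite_measure_mono) auto
  moreover have "prob (?Z n (x n)) > 0"
    by (intro vertex inv_limit_vertex[OF xX]) (simp_all add: n_def)
  ultimately show ?thesis by simp
qed

theorem lemma6p22:
  fixes G :: "nat \<Rightarrow> 'v pair_pre_digraph"
    and \<phi> :: "nat \<Rightarrow> 'v \<Rightarrow> 'v"
    and v :: "nat \<Rightarrow> 'v"
    and e c a :: "nat \<Rightarrow> 'v vwalk"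
    and s s' t t' :: "nat \<Rightarrow> nat"
    and X K :: "(nat \<Rightarrow> 'v) set"
    and T :: "(nat \<Rightarrow> 'v) topology"
    and f :: "(nat \<Rightarrow> 'v) \<Rightarrow> (nat \<Rightarrow> 'v)"
    and p :: "nat \<Rightarrow> 'v"
    and \<mu>\<^sub>p \<mu>\<^sub>c :: "(nat \<Rightarrow> 'v) measure"
  assumes "bidirectional_covering G \<phi>"
    and "KR_covering G \<phi> v"
    and "proximal G"
    and "\<And>n. n \<ge> 1 \<Longrightarrow> circuits_at (G n) (v n) = {e n, c n}"
    and "\<And>n. n \<ge> 1 \<Longrightarrow> e n \<noteq> c n"
    and "\<And>n. n \<ge> 1 \<Longrightarrow> vwalk_length (e n) = 1"
    and "\<And>n. n \<ge> 1 \<Longrightarrow> s n \<ge> 1 \<and> s' n \<ge> 1 \<and> t n \<ge> 2 \<and> t' n \<ge> 2"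
    and "\<And>n. n \<ge> 1 \<Longrightarrow> \<exists>ws \<in> lists {e n, c n}. a n = walk_prod (v n) ws"
    and "\<And>n. n \<ge> 1 \<Longrightarrow> map (\<phi> (Suc n)) (c (Suc n)) =
           walk_prod (v n)
             [walk_power (v n) (e n) (s n), walk_power (v n) (c n) (t n), a n,
              walk_power (v n) (c n) (t' n), walk_power (v n) (e n) (s' n)]"
    and "X = inv_limit G \<phi>"
    and "T = inv_limit_top G \<phi>"
    and "f = inv_limit_map G \<phi>"
    and "p = (\<lambda>n. v n)"
    and "\<mu>\<^sub>p = return (borel_of T) p"
    and "card {\<mu>. ergodic_measure T f \<mu>} = 2"
    and "ergodic_measure T f \<mu>\<^sub>c"
    and "\<mu>\<^sub>c \<noteq> \<mu>\<^sub>p"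
    and "K = X - (stable_set T f p \<union> unstable_set T f p)"
  shows "measure \<mu>\<^sub>c K = 1 \<and> (\<forall>U. openin T U \<and> U \<noteq> {} \<longrightarrow> measure \<mu>\<^sub>c U > 0)"
proof -
  note bi = assms(1) and KR = assms(2) and T = assms(11) and f = assms(12)
  have cov: "covering G \<phi>" using bi by (simp add: bidirectional_covering_def)
  have fig: "generalized_figure_8 (G n) (v n)" and center: "\<phi> (Suc n) (v (Suc n)) = v n" for n
    using KR by (auto simp: KR_covering_def)
  have v_X: "v \<in> inv_limit G \<phi>"
    using fig center by (intro inv_limitI) (simp_all add: generalized_figure_8_def)
  have looped: "looped_figure_8 (G n) (v n) (c n)" if n: "n \<ge> 1" for n
  proof -
    have e: "e n \<in> circuits_at (G n) (v n)" using assms(4)[OF n] by simp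
    have "length (e n) = 2" using assms(6)[OF n] by simp
    then obtain x y where "e n = [x, y]" by (auto simp: numeral_2_eq_2 length_Suc_conv)
    then have "e n = [v n, v n]" using e by (auto simp: circuits_at_def circuit_def)
    then show ?thesis
      using fig assms(4)[OF n] assms(5)[OF n] by unfold_locales auto
  qed
  have loop: "(v n, v n) \<in> parcs (G n)" for n
  proof (cases "n = 0")
    case False
    then show ?thesis using looped_figure_8.loop_arc[OF looped] by simp
  next
    case True
    obtain w where "pverts (G 0) = {w}" "parcs (G 0) = {(w, w)}"
      using cov by (auto simp: covering_def)
    then show ?thesis using inv_limit_vertex[OF v_X, of 0] True by auto
  qed
  have fixed: "inv_limit_map G \<phi> v = v"
    using loop by (intro inv_limit_map_eqI[OF cov v_X v_X])
  have p_eq: "p = v" using assms(13) by simp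
  have erg: "ergodic_measure (inv_limit_top G \<phi>) (inv_limit_map G \<phi>) \<mu>\<^sub>c"
    using assms(16) T f by simp
  have null: "measure \<mu>\<^sub>c {v} = 0"
    using ergodic_measure_fixed_point_null[OF bi v_X fixed erg] assms(14,17) T p_eq by simp
  have \<mu>: "prob_space \<mu>\<^sub>c" "sets \<mu>\<^sub>c = sets (borel_of (inv_limit_top G \<phi>))"
    "inv_limit_map G \<phi> \<in> measurable \<mu>\<^sub>c \<mu>\<^sub>c" "distr \<mu>\<^sub>c \<mu>\<^sub>c (inv_limit_map G \<phi>) = \<mu>\<^sub>c"
    using erg by (auto simp: ergodic_measure_def)
  interpret prob_space \<mu>\<^sub>c by (rule \<mu>(1))
  have space: "space \<mu>\<^sub>c = X" using sets_eq_imp_space_eq[OF \<mu>(2)] assms(10) by simp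
  note S = stable_set_null[OF cov v_X \<mu>(1,2,4) null, folded f T p_eq]
  note U = unstable_set_null[OF bi v_X \<mu>(1,2,4) null, folded f T p_eq]
  have "prob (stable_set T f p \<union> unstable_set T f p)
      \<le> prob (stable_set T f p) + prob (unstable_set T f p)"
    by (rule measure_Un_le[OF S(1) U(1)])
  then have "prob (stable_set T f p \<union> unstable_set T f p) = 0"
    using S(2) U(2) by (simp add: measure_le_0_iff)
  moreover have "K = space \<mu>\<^sub>c - (stable_set T f p \<union> unstable_set T f p)"
    using assms(18) space by simp
  ultimately have "prob K = 1"
    using prob_compl[of "stable_set T f p \<union> unstable_set T f p"] S(1) U(1) by simp
  moreover have "prob V > 0" if "openin T V" "V \<noteq> {}" for V
    using looped_figure_8_covering_full_support[OF cov v_X looped \<mu> null] that T by simp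
  ultimately show ?thesis by blast
qed

end
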